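(* The Fourier transform $\mathcal F$ maps $J(A^2)$ onto $$X=\Big\{g\in L^2(\mathbb T):\ \operatorname{supp}g\subseteq[0,\pi],\ \int_0^\pi|g(t)|^2\,\frac{1+\sin t}{2\sin t}\,dt<\infty\Big\}.$$ Moreover, for every $f\in A^2$, $$\|f\|_{A^2}^2=\int_0^\pi|\mathcal F(Jf)(t)|^2\,\frac{1+\sin t}{2\sin t}\,dt.$$
   Context: Lattice points $(m,n)\in\mathbb Z^2$ are identified with $m+in\in\mathbb C$. Let $\mathbb Z^2_+=\{m+in: m,n\in\mathbb Z,\ n\geqslant 0\}$. A function $f:\mathbb Z^2_+\to\mathbb C$ is discrete holomorphic, written $f\in\operatorname{Hol}(\mathbb Z^2_+)$, if $f(z)+i f(z+1)-f(z+1+i)-i f(z+i)=0$ for every $z\in\mathbb Z^2_+$. The Bergman space is $A^2=A^2(\mathbb Z^2_+)=\{f\in\operatorname{Hol}(\mathbb Z^2_+):\|f\|_{A^2}^2:=\sum_{n=0}^{+\infty}\sum_{m=-\infty}^{+\infty}|f(m+in)|^2<\infty\}$. $J$ is the restriction operator to the boundary: $Jf=(f(m))_{m\in\mathbb Z}\in\ell^2(\mathbb Z)$. $\mathbb T=\mathbb R/2\pi\mathbb Z$ is identified with $[-\pi,\pi]$ with unnormalized Lebesgue measure. The Fourier transform $\mathcal F:\ell^2(\mathbb Z)\to L^2([-\pi,\pi])$ is $(\mathcal Ff)(t)=\frac1{\sqrt{2\pi}}\sum_{m\in\mathbb Z}f(m)e^{-imt}$. For $g\in L^2(\mathbb T)$,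 $\operatorname{supp}g\subseteq[0,\pi]$ means $g=0$ a.e. on $(-\pi,0)$. *)

theory Defs
  imports "HOL-Analysis.Analysis"
begin

text \<open>A function on the lattice half-plane is a curried function, \<open>f m n\<close> being the value at
  \<open>m + i n\<close> for an integer \<open>m\<close> and a natural number \<open>n\<close>.\<close>

definition discrete_holomorphic :: "(int \<Rightarrow> nat \<Rightarrow> complex) \<Rightarrow> bool" where
  "discrete_holomorphic f \<longleftrightarrow>
     (\<forall>m n. f m n + \<i> * f (m + 1) n - f (m + 1) (n + 1) - \<i> * f m (n + 1) = 0)"

definition bergman_norm_sq :: "(int \<Rightarrow> nat \<Rightarrow> complex) \<Rightarrow> ennreal" where
  "bergman_norm_sq f = (\<Sum>n. \<Sum>\<^sub>\<infinity>m\<in>UNIV. ennreal ((cmod (f m n))\<^sup>2))"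

definition bergman_space :: "(int \<Rightarrow> nat \<Rightarrow> complex) set" where
  "bergman_space = {f. discrete_holomorphic f \<and> bergman_norm_sq f < \<infinity>}"

definition boundary :: "(int \<Rightarrow> nat \<Rightarrow> complex) \<Rightarrow> int \<Rightarrow> complex" where
  "boundary f = (\<lambda>m. f m 0)"

abbreviation circle :: "real measure" where
  "circle \<equiv> lebesgue_on {-pi..pi}"

definition square_integrable :: "(real \<Rightarrow> complex) set" where
  "square_integrable = {g \<in> borel_measurable circle.
     (\<integral>\<^sup>+ t. ennreal ((cmod (g t))\<^sup>2) \<partial>circle) < \<infinity>}"

text \<open>Elements of \<open>L\<^sup>2\<close> of the circle are almost-everywhere classes of square integrable functions.
  Values outside \<open>[-\<pi>, \<pi>]\<close> are irrelevant to the class.\<close>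

definition L2_class :: "(real \<Rightarrow> complex) \<Rightarrow> (real \<Rightarrow> complex) set" where
  "L2_class g = {h \<in> square_integrable. AE t in circle. h t = g t}"

text \<open>The sum of the Fourier series in \<open>L\<^sup>2\<close>, as the set of all its representatives. By
  \<open>fourier_eq_L2_class\<close> below this set, if nonempty, is a single \<open>L\<^sup>2\<close> class; it is
  empty precisely when the series does not converge, i.e. for sequences outside \<open>\<ell>\<^sup>2\<close>.\<close>

definition fourier :: "(int \<Rightarrow> complex) \<Rightarrow> (real \<Rightarrow> complex) set" where
  "fourier a = {g \<in> square_integrable.
     ((\<lambda>F. \<integral>\<^sup>+ t. ennreal ((cmod (complex_of_real (1 / sqrt (2 * pi)) *
          (\<Sum>m\<in>F. a m * exp (- \<i> * of_int m * of_real t)) - g t))\<^sup>2) \<partial>circle)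
        \<longlongrightarrow> 0) (finite_subsets_at_top UNIV)}"

definition weighted_norm_sq :: "(real \<Rightarrow> complex) \<Rightarrow> ennreal" where
  "weighted_norm_sq g =
     (\<integral>\<^sup>+ t\<in>{0..pi}. ennreal ((cmod (g t))\<^sup>2 * ((1 + sin t) / (2 * sin t))) \<partial>circle)"

definition weighted_space :: "(real \<Rightarrow> complex) set set" where
  "weighted_space = L2_class ` {g \<in> square_integrable.
     (AE t in circle. -pi < t \<and> t < 0 \<longrightarrow> g t = 0) \<and> weighted_norm_sq g < \<infinity>}"

lemma ennreal_norm_diff_sq_le:
  fixes x y z :: complex
  shows "ennreal ((cmod (x - z))\<^sup>2)
    \<le> 2 * ennreal ((cmod (y - x))\<^sup>2) + 2 * ennreal ((cmod (y - z))\<^sup>2)"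
proof -
  have "cmod (x - z) \<le> cmod (y - x) + cmod (y - z)"
    by (metis dist_norm dist_commute dist_triangle)
  then have "(cmod (x - z))\<^sup>2 \<le> (cmod (y - x) + cmod (y - z))\<^sup>2"
    by (intro power_mono) auto
  also have "\<dots> \<le> 2 * (cmod (y - x))\<^sup>2 + 2 * (cmod (y - z))\<^sup>2"
    using zero_le_power2[of "cmod (y - x) - cmod (y - z)"] by (simp add: power2_eq_square algebra_simps)
  finally have "ennreal ((cmod (x - z))\<^sup>2) \<le> ennreal (2 * (cmod (y - x))\<^sup>2 + 2 * (cmod (y - z))\<^sup>2)"
    by (rule ennreal_leI)
  then show ?thesis
    by (simp add: ennreal_plus ennreal_mult)
qed

lemma fourier_eq_L2_class:
  assumes g: "g \<in> fourier a"
  shows "fourier a = L2_class g"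
proof -
  define S where "S F t = complex_of_real (1 / sqrt (2 * pi)) *
      (\<Sum>m\<in>F. a m * exp (- \<i> * of_int m * of_real t))" for F :: "int set" and t :: real
  define E where "E h F = (\<integral>\<^sup>+ t. ennreal ((cmod (S F t - h t))\<^sup>2) \<partial>circle)" for h F
  have four: "h \<in> fourier a \<longleftrightarrow> h \<in> square_integrable \<and>
      (E h \<longlongrightarrow> 0) (finite_subsets_at_top UNIV)" for h
    unfolding fourier_def mem_Collect_eq E_def[abs_def] S_def by (rule refl)
  have S [measurable]: "S F \<in> borel_measurable circle" for F
  proof -
    have "continuous_on UNIV (S F)"
      unfolding S_def by (intro continuous_intros)
    then show ?thesis
      by (intro measurable_restrict_space1 measurable_completion)
        (simp add: borel_measurable_continuous_onI)
  qed
  have gm [measurable]: "g \<in> borel_measurable circle"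
    using g by (auto simp: fourier_def square_integrable_def)
  show ?thesis
  proof (intro equalityI subsetI)
    fix h assume h: "h \<in> fourier a"
    have hm [measurable]: "h \<in> borel_measurable circle"
      using h by (auto simp: fourier_def square_integrable_def)
    let ?D = "\<integral>\<^sup>+ t. ennreal ((cmod (h t - g t))\<^sup>2) \<partial>circle"
    have le: "?D \<le> 2 * E h F + 2 * E g F" for F
    proof -
      have "?D \<le> (\<integral>\<^sup>+ t. 2 * ennreal ((cmod (S F t - h t))\<^sup>2)
          + 2 * ennreal ((cmod (S F t - g t))\<^sup>2) \<partial>circle)"
        by (intro nn_integral_mono ennreal_norm_diff_sq_le)
      also have "\<dots> = 2 * E h F + 2 * E g F"
        unfolding E_def by (subst nn_integral_add) (auto simp: nn_integral_cmult)
      finally show ?thesis .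
    qed
    have "((\<lambda>F. 2 * E h F + 2 * E g F) \<longlongrightarrow> 2 * 0 + 2 * 0) (finite_subsets_at_top UNIV)"
      using h g by (intro tendsto_add ennreal_tendsto_cmult) (auto simp: four)
    then have "?D \<le> 2 * 0 + 2 * 0"
      by (rule tendsto_lowerbound) (auto intro: always_eventually le)
    then have "AE t in circle. ennreal ((cmod (h t - g t))\<^sup>2) = 0"
      by (subst nn_integral_0_iff_AE[symmetric]) auto
    then have "AE t in circle. h t = g t"
      by eventually_elim auto
    then show "h \<in> L2_class g"
      using h by (simp add: L2_class_def four)
  next
    fix h assume h: "h \<in> L2_class g"
    then have "AE t in circle. h t = g t"
      by (simp add: L2_class_def)
    then have "E h F = E g F" for F
      unfolding E_def by (intro nn_integral_cong_AE) auto
    then have "E h = E g" by blast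
    then show "h \<in> fourier a"
      using h g by (simp add: L2_class_def four)
  qed
qed

end

theory Submission
  imports Defs
begin

text \<open>On the Fourier side, the shift by \<open>1\<close> is multiplication by \<open>e\<^sup>i\<^sup>t\<close>, so discrete holomorphy says that the
  transforms \<open>g\<^sub>n\<close> of the rows satisfy \<open>(1 + i e\<^sup>i\<^sup>t) g\<^sub>n = (e\<^sup>i\<^sup>t + i) g\<^sub>n\<^sub>+\<^sub>1\<close>. Hence
  \<open>|g\<^sub>n|\<^sup>2 = q\<^sup>n |g\<^sub>0|\<^sup>2\<close> with \<open>q = (1 - sin t) / (1 + sin t)\<close>. By Parseval's identity the Bergman norm is the
  integral of \<open>|g\<^sub>0|\<^sup>2\<close> against a geometric series, which diverges on \<open>(-\<pi>, 0)\<close> and has the sum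
  \<open>(1 + sin t) / (2 sin t)\<close> on \<open>(0, \<pi>)\<close>.\<close>

section \<open>Square integrable functions and Fourier coefficients\<close>

text \<open>The obstacle is that discrete holomorphy constrains the rows entry by entry, whereas the
  decay of \<open>|g_n|\<close> needs an identity of functions at almost every \<open>t\<close>.
  Three facts about \<open>fourier\<close> bridge the gap: every square summable row has a transform
  (Riesz-Fischer), Parseval's identity, and completeness: an integrable function whose coefficients
  all vanish is zero almost everywhere. Completeness turns the recurrence for the coefficients into
  the multiplier equation. It also serves the converse, where the rows of \<open>f\<close> are
  defined as coefficients of prescribed functions and must have these functions as their transforms.
  The multiplier equation can be solved for the next row except where e^(it) + i vanishes, which
  happens on the circle only at -pi/2, a null set. On (0, pi) the quotient of the two multipliers
  has modulus below 1, so its powers keep every admissible boundary function square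
  integrable.\<close>

definition trig :: "int \<Rightarrow> real \<Rightarrow> complex" where
  "trig m t = complex_of_real (1 / sqrt (2 * pi)) * exp (- \<i> * of_int m * of_real t)"

text \<open>This is the inverse transform: \<open>coef_fourier\<close> and
  \<open>fourier_coef\<close> show that it undoes \<open>fourier\<close>. The integral also makes
  sense for a function that is merely integrable, the setting in which completeness is
  proved.\<close>

definition coef :: "(real \<Rightarrow> complex) \<Rightarrow> int \<Rightarrow> complex" where
  "coef g m = (\<integral>t. g t * cnj (trig m t) \<partial>circle)"

definition trig_sum :: "(int \<Rightarrow> complex) \<Rightarrow> int set \<Rightarrow> real \<Rightarrow> complex" where
  "trig_sum a F t = (\<Sum>m\<in>F. a m * trig m t)"

definition norm_sq :: "(real \<Rightarrow> complex) \<Rightarrow> ennreal" where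
  "norm_sq g = (\<integral>\<^sup>+t. ennreal ((cmod (g t))\<^sup>2) \<partial>circle)"

lemma finite_measure_circle: "finite_measure circle"
  by (intro finite_measure_lebesgue_on) auto

lemma continuous_imp_measurable_circle:
  fixes f :: "real \<Rightarrow> 'a :: euclidean_space"
  assumes "continuous_on {-pi..pi} f"
  shows "f \<in> borel_measurable circle"
  using assms by (intro continuous_imp_measurable_on_sets_lebesgue) auto

lemma trig_measurable [measurable]: "trig m \<in> borel_measurable circle"
  unfolding trig_def by (intro continuous_imp_measurable_circle continuous_intros)

lemma trig_sum_measurable [measurable]: "trig_sum a F \<in> borel_measurable circle"
  unfolding trig_sum_def by measurable

lemma cnj_trig_measurable [measurable]: "(\<lambda>t. cnj (trig m t)) \<in> borel_measurable circle"
  unfolding trig_def by (intro continuous_imp_measurable_circle continuous_intros)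

lemma norm_trig: "cmod (trig m t) = 1 / sqrt (2 * pi)"
proof -
  have "cmod (exp (- \<i> * of_int m * of_real t)) = 1"
    by (simp add: norm_exp_eq_Re)
  then show ?thesis
    by (simp add: trig_def norm_mult norm_divide)
qed

lemma trig_add: "trig (m + k) t = trig m t * exp (- \<i> * of_int k * of_real t)"
  by (simp add: trig_def exp_add [symmetric] algebra_simps)

lemma square_integrable_iff:
  "g \<in> square_integrable \<longleftrightarrow> g \<in> borel_measurable circle \<and> norm_sq g < \<infinity>"
  by (simp add: square_integrable_def norm_sq_def)

lemma square_integrable_measurable:
  "g \<in> square_integrable \<Longrightarrow> g \<in> borel_measurable circle"
  by (simp add: square_integrable_def)

lemma square_integrable_mono:
  assumes "g \<in> square_integrable" "h \<in> borel_measurable circle"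
    and "AE t in circle. cmod (h t) \<le> C * cmod (g t)"
  shows "h \<in> square_integrable"
proof -
  have "norm_sq h \<le> (\<integral>\<^sup>+t. ennreal (C\<^sup>2) * ennreal ((cmod (g t))\<^sup>2) \<partial>circle)"
    unfolding norm_sq_def using assms(3)
  proof (intro nn_integral_mono_AE, eventually_elim)
    case (elim t)
    have "(cmod (h t))\<^sup>2 \<le> (C * cmod (g t))\<^sup>2"
      using elim by (intro power_mono) auto
    then show ?case
      by (simp add: power_mult_distrib ennreal_mult [symmetric] ennreal_leI)
  qed
  also have "\<dots> = ennreal (C\<^sup>2) * norm_sq g"
    using assms(1) unfolding norm_sq_def
    by (intro nn_integral_cmult) (auto simp: square_integrable_def)
  also have "\<dots> < \<infinity>"
    using assms(1) by (simp add: square_integrable_iff ennreal_mult_less_top)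
  finally show ?thesis
    using assms(2) by (simp add: square_integrable_iff)
qed

lemma norm_sq_diff_le:
  assumes [measurable]: "h \<in> borel_measurable circle" "g \<in> borel_measurable circle"
    "k \<in> borel_measurable circle"
  shows "norm_sq (\<lambda>t. g t - h t) \<le> 2 * norm_sq (\<lambda>t. k t - g t) + 2 * norm_sq (\<lambda>t. k t - h t)"
proof -
  have "norm_sq (\<lambda>t. g t - h t) \<le> (\<integral>\<^sup>+ t. 2 * ennreal ((cmod (k t - g t))\<^sup>2)
          + 2 * ennreal ((cmod (k t - h t))\<^sup>2) \<partial>circle)"
    unfolding norm_sq_def by (intro nn_integral_mono ennreal_norm_diff_sq_le)
  also have "\<dots> = 2 * norm_sq (\<lambda>t. k t - g t) + 2 * norm_sq (\<lambda>t. k t - h t)"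
    unfolding norm_sq_def by (subst nn_integral_add) (auto simp: nn_integral_cmult)
  finally show ?thesis .
qed

lemma norm_sq_uminus: "norm_sq (\<lambda>t. - g t) = norm_sq g"
  by (simp add: norm_sq_def)

lemma square_integrable_diff:
  assumes "g \<in> square_integrable" "h \<in> square_integrable"
  shows "(\<lambda>t. g t - h t) \<in> square_integrable"
proof -
  have [measurable]: "g \<in> borel_measurable circle" "h \<in> borel_measurable circle"
    using assms by (auto dest: square_integrable_measurable)
  have "norm_sq (\<lambda>t. g t - h t) \<le> 2 * norm_sq g + 2 * norm_sq h"
    using norm_sq_diff_le[of h g "\<lambda>_. 0"] by (simp add: norm_sq_uminus)
  also have "\<dots> < \<infinity>"
    using assms by (auto simp: square_integrable_iff ennreal_mult_less_top)
  finally show ?thesis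
    by (simp add: square_integrable_iff)
qed

lemma square_integrable_uminus:
  "g \<in> square_integrable \<Longrightarrow> (\<lambda>t. - g t) \<in> square_integrable"
  by (simp add: square_integrable_def)

lemma square_integrable_add:
  assumes "g \<in> square_integrable" "h \<in> square_integrable"
  shows "(\<lambda>t. g t + h t) \<in> square_integrable"
  using square_integrable_diff[OF assms(1) square_integrable_uminus[OF assms(2)]] by simp

lemma square_integrable_mult_bounded:
  assumes g: "g \<in> square_integrable" and u: "u \<in> borel_measurable circle" "\<And>t. cmod (u t) \<le> C"
  shows "(\<lambda>t. g t * u t) \<in> square_integrable"
proof (rule square_integrable_mono[OF g])
  show "(\<lambda>t. g t * u t) \<in> borel_measurable circle"
    using u(1) square_integrable_measurable[OF g] by simp
  show "AE t in circle. cmod (g t * u t) \<le> C * cmod (g t)"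
    using u(2) by (intro always_eventually allI) (metis norm_mult mult.commute mult_right_mono norm_ge_zero)
qed

lemma square_integrable_bounded:
  assumes u: "u \<in> borel_measurable circle" "\<And>t. cmod (u t) \<le> C"
  shows "u \<in> square_integrable"
proof (rule square_integrable_mono[of "\<lambda>_. 1"])
  show "(\<lambda>_. 1) \<in> square_integrable"
    using finite_measure.emeasure_finite[OF finite_measure_circle]
    by (simp add: square_integrable_def top.not_eq_extremum)
qed (use u in auto)

lemma integrable_norm_sq:
  "g \<in> square_integrable \<Longrightarrow> integrable circle (\<lambda>t. (cmod (g t))\<^sup>2)"
  by (auto simp: integrable_iff_bounded square_integrable_def)

lemma norm_sq_eq:
  "g \<in> square_integrable \<Longrightarrow> norm_sq g = ennreal (\<integral>t. (cmod (g t))\<^sup>2 \<partial>circle)"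
  unfolding norm_sq_def by (intro nn_integral_eq_integral integrable_norm_sq) auto

lemma integrable_square_integrable:
  assumes "g \<in> square_integrable"
  shows "integrable circle g"
proof (rule Bochner_Integration.integrable_bound)
  interpret finite_measure circle by (rule finite_measure_circle)
  show "integrable circle (\<lambda>t. 1 + (cmod (g t))\<^sup>2)"
    using integrable_norm_sq[OF assms] by (intro Bochner_Integration.integrable_add) auto
  have "x \<le> 1 + x\<^sup>2" for x :: real
    using zero_le_power2[of "x - 1/2"] by (simp add: power2_eq_square algebra_simps)
  then show "AE t in circle. norm (g t) \<le> norm (1 + (cmod (g t))\<^sup>2)"
    by (intro always_eventually allI) (smt (verit) real_norm_def)
qed (use assms in \<open>auto dest: square_integrable_measurable\<close>)

lemma norm_trig_le: "cmod (trig m t) \<le> 1"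
proof -
  have "1 \<le> 2 * pi" using pi_gt3 by simp
  then show ?thesis by (simp add: norm_trig)
qed

lemma integrable_mult_cnj_trig:
  assumes "integrable circle g"
  shows "integrable circle (\<lambda>t. g t * cnj (trig m t))"
proof (rule Bochner_Integration.integrable_bound[OF assms])
  show "AE t in circle. norm (g t * cnj (trig m t)) \<le> norm (g t)"
    using norm_trig_le by (intro always_eventually allI) (simp add: norm_mult mult_left_le)
qed (use assms in auto)

lemma coef_add:
  "integrable circle g \<Longrightarrow> integrable circle h \<Longrightarrow> coef (\<lambda>t. g t + h t) m = coef g m + coef h m"
  by (simp add: coef_def distrib_right integrable_mult_cnj_trig)

lemma coef_diff:
  "integrable circle g \<Longrightarrow> integrable circle h \<Longrightarrow> coef (\<lambda>t. g t - h t) m = coef g m - coef h m"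
  by (simp add: coef_def left_diff_distrib integrable_mult_cnj_trig)

lemma coef_cmult: "coef (\<lambda>t. c * g t) m = c * coef g m"
  by (simp add: coef_def mult.assoc)

text \<open>The conjugate of \<open>trig m\<close> carries e^(imt), so an extra factor e^(ikt) moves
  the index up by \<open>k\<close>.\<close>

lemma coef_mult_exp: "coef (\<lambda>t. exp (\<i> * of_int k * of_real t) * g t) m = coef g (m + k)"
proof -
  have "cnj (trig (m + k) t) = exp (\<i> * of_int k * of_real t) * cnj (trig m t)" for t
    by (simp add: trig_add exp_cnj)
  then show ?thesis
    by (simp add: coef_def mult_ac)
qed

lemma coef_cong_AE:
  assumes "g \<in> borel_measurable circle" "h \<in> borel_measurable circle" "AE t in circle. g t = h t"
  shows "coef g = coef h"
  unfolding coef_def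
  by (intro ext integral_cong_AE) (use assms in \<open>auto elim: eventually_mono\<close>)

section \<open>Orthonormality and the mean square error of trigonometric sums\<close>

lemma integral_circle_exp:
  "(\<integral>t. exp (\<i> * of_int k * of_real t) \<partial>circle) = (if k = 0 then of_real (2 * pi) else 0)"
proof (cases "k = 0")
  case True
  then show ?thesis by (simp add: measure_restrict_space scaleR_conv_of_real)
next
  case False
  let ?F = "\<lambda>z. exp (\<i> * of_int k * z) / (\<i> * of_int k)"
  have "((\<lambda>t. exp (\<i> * of_int k * of_real t)) has_integral (?F (of_real pi) - ?F (of_real (-pi)))) {-pi..pi}"
  proof (rule fundamental_theorem_of_calculus)
    fix t :: real
    have "(?F has_field_derivative exp (\<i> * of_int k * of_real t)) (at (of_real t))"
      using False by (auto intro!: derivative_eq_intros)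
    then show "((\<lambda>t. ?F (of_real t)) has_vector_derivative exp (\<i> * of_int k * of_real t)) (at t within {-pi..pi})"
      by (rule has_vector_derivative_real_field)
  qed simp
  \<comment> \<open>The two exponents differ by 2 pi k i, a period of \<open>exp\<close>.\<close>
  moreover have "?F (of_real pi) = ?F (of_real (-pi))"
  proof -
    have *: "exp (\<i> * of_int k * of_real (-pi) + (2 * of_int k * of_real pi) * \<i>) = exp (\<i> * of_int k * of_real (-pi))"
      using exp_integer_2pi[of "of_int k"] by (simp only: exp_add) simp
    have "x * (- p) + (2 * y * p) * j = x * p" if "x = j * y" for x y p j :: complex
      unfolding that by (simp add: algebra_simps)
    then have "\<i> * of_int k * of_real (-pi) + (2 * of_int k * of_real pi) * \<i> = \<i> * of_int k * of_real pi"
      by (simp only: of_real_minus)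
    with * show ?thesis by (simp only:)
  qed
  ultimately have "((\<lambda>t. exp (\<i> * of_int k * of_real t)) has_integral 0) {-pi..pi}"
    by simp
  moreover have "integrable circle (\<lambda>t. exp (\<i> * of_int k * of_real t))"
    by (intro integrable_square_integrable square_integrable_bounded[where C = 1]
        continuous_imp_measurable_circle continuous_intros) (simp add: norm_exp_eq_Re)
  ultimately show ?thesis
    using False by (simp add: lebesgue_integral_eq_integral integral_unique)
qed

lemma coef_trig: "coef (trig n) m = (if m = n then 1 else 0)"
proof -
  have "trig n t * cnj (trig m t) = of_real (1 / (2 * pi)) * exp (\<i> * of_int (m - n) * of_real t)" for t
  proof -
    have "complex_of_real (1 / sqrt (2 * pi)) * of_real (1 / sqrt (2 * pi)) = of_real (1 / (2 * pi))"
      by (simp flip: of_real_mult)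
    moreover have "exp (- \<i> * of_int n * of_real t) * exp (\<i> * of_int m * of_real t)
        = exp (\<i> * of_int (m - n) * of_real t)"
      by (simp add: exp_add [symmetric] algebra_simps)
    moreover have "trig n t * cnj (trig m t) =
       (complex_of_real (1 / sqrt (2 * pi)) * of_real (1 / sqrt (2 * pi)))
        * (exp (- \<i> * of_int n * of_real t) * exp (\<i> * of_int m * of_real t))"
      by (simp add: trig_def exp_cnj)
    ultimately show ?thesis by simp
  qed
  then show ?thesis
    using integral_circle_exp[of "m - n"] by (simp add: coef_def)
qed

lemma square_integrable_trig: "trig m \<in> square_integrable"
  using norm_trig_le by (intro square_integrable_bounded) auto

lemma square_integrable_cmult: "g \<in> square_integrable \<Longrightarrow> (\<lambda>t. c * g t) \<in> square_integrable"
  using square_integrable_mult_bounded[of g "\<lambda>_. c" "cmod c"] by (simp add: mult.commute)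

lemma square_integrable_trig_sum: "trig_sum a F \<in> square_integrable"
  unfolding trig_sum_def
proof (induction F rule: infinite_finite_induct)
  case (insert m F)
  then show ?case
    by (simp add: square_integrable_add square_integrable_cmult square_integrable_trig)
qed (auto simp: square_integrable_def)

lemma coef_trig_sum: "finite F \<Longrightarrow> coef (trig_sum a F) m = (if m \<in> F then a m else 0)"
proof (induction F rule: finite_induct)
  case empty
  then show ?case by (simp add: trig_sum_def coef_def)
next
  case (insert n F)
  have "trig_sum a (insert n F) = (\<lambda>t. a n * trig n t + trig_sum a F t)"
    using insert by (simp add: trig_sum_def fun_eq_iff)
  then have "coef (trig_sum a (insert n F)) m = a n * coef (trig n) m + coef (trig_sum a F) m"
    by (simp add: coef_add integrable_square_integrable square_integrable_trig_sum
      square_integrable_cmult square_integrable_trig coef_cmult)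
  then show ?case
    using insert by (auto simp: coef_trig)
qed

text \<open>Expanding the square gives the cross term \<open>2 * Re (cnj c * coef h m)\<close> and
  the square of \<open>cmod c\<close>, since \<open>trig m\<close> has norm one; completing the
  square yields this form. It is the inductive step for adding one frequency to a sum.\<close>

lemma norm_add_trig_sq:
  assumes h: "h \<in> square_integrable"
  shows "(\<integral>t. (cmod (h t + c * trig m t))\<^sup>2 \<partial>circle)
    = (\<integral>t. (cmod (h t))\<^sup>2 \<partial>circle) + (cmod (coef h m + c))\<^sup>2 - (cmod (coef h m))\<^sup>2"
proof -
  interpret finite_measure circle by (rule finite_measure_circle)
  have eq: "(cmod (h t + c * trig m t))\<^sup>2
      = (cmod (h t))\<^sup>2 + 2 * Re (cnj c * (h t * cnj (trig m t))) + (cmod c)\<^sup>2 / (2 * pi)" for t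
  proof -
    have "(cmod (c * trig m t))\<^sup>2 = (cmod c)\<^sup>2 / (2 * pi)"
      by (simp add: norm_mult norm_trig power_mult_distrib power_divide)
    moreover have sq: "(cmod (x + y))\<^sup>2 = (cmod x)\<^sup>2 + 2 * Re (x * cnj y) + (cmod y)\<^sup>2" for x y
      unfolding cmod_power2 by (simp add: power2_eq_square algebra_simps)
    ultimately show ?thesis unfolding sq by (simp add: mult_ac)
  qed
  have i1: "integrable circle (\<lambda>t. (cmod (h t))\<^sup>2)"
    by (rule integrable_norm_sq[OF h])
  have i2: "integrable circle (\<lambda>t. cnj c * (h t * cnj (trig m t)))"
    by (intro integrable_mult_right integrable_mult_cnj_trig integrable_square_integrable h)
  have "(\<integral>t. (cmod (h t + c * trig m t))\<^sup>2 \<partial>circle)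
    = (\<integral>t. (cmod (h t))\<^sup>2 \<partial>circle) + 2 * (\<integral>t. Re (cnj c * (h t * cnj (trig m t))) \<partial>circle) + (cmod c)\<^sup>2"
    unfolding eq using i1 i2
    by (simp add: measure_restrict_space del: times_complex.sel)
  also have "(\<integral>t. Re (cnj c * (h t * cnj (trig m t))) \<partial>circle) = Re (cnj c * coef h m)"
    unfolding coef_def by (subst integral_Re[OF i2]) simp
  also have "(\<integral>t. (cmod (h t))\<^sup>2 \<partial>circle) + 2 * Re (cnj c * coef h m) + (cmod c)\<^sup>2
    = (\<integral>t. (cmod (h t))\<^sup>2 \<partial>circle) + (cmod (coef h m + c))\<^sup>2 - (cmod (coef h m))\<^sup>2"
    unfolding cmod_power2 by (simp add: power2_eq_square algebra_simps)
  finally show ?thesis .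
qed

text \<open>Each new frequency subtracts \<open>|coef g n|^2\<close> and adds
  \<open>|a n - coef g n|^2\<close>. Taking \<open>a = coef g\<close> gives Bessel's inequality and
  the exact error used for Parseval; taking \<open>g = 0\<close> gives the norm of a trigonometric
  sum.\<close>

lemma integral_norm_trig_sum_diff:
  assumes g: "g \<in> square_integrable" and "finite F"
  shows "(\<integral>t. (cmod (trig_sum a F t - g t))\<^sup>2 \<partial>circle)
    = (\<integral>t. (cmod (g t))\<^sup>2 \<partial>circle) - (\<Sum>m\<in>F. (cmod (coef g m))\<^sup>2) + (\<Sum>m\<in>F. (cmod (a m - coef g m))\<^sup>2)"
  using \<open>finite F\<close>
proof (induction F rule: finite_induct)
  case empty
  then show ?case by (simp add: trig_sum_def)
next
  case (insert n F)
  let ?h = "\<lambda>t. trig_sum a F t - g t"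
  have "?h \<in> square_integrable"
    by (intro square_integrable_diff square_integrable_trig_sum g)
  moreover have *: "trig_sum a (insert n F) t - g t = ?h t + a n * trig n t" for t
    using insert by (simp add: trig_sum_def)
  \<comment> \<open>As \<open>n\<close> is not in \<open>F\<close>, orthogonality removes the
    contribution of the partial sum.\<close>
  moreover have "coef ?h n = - coef g n"
    using insert by (simp add: coef_diff integrable_square_integrable g square_integrable_trig_sum coef_trig_sum)
  ultimately show ?case
    unfolding * using insert by (simp add: norm_add_trig_sq norm_minus_commute)
qed

section \<open>The Riesz-Fischer theorem\<close>

lemma integral_norm_trig_sum:
  assumes "finite F"
  shows "(\<integral>t. (cmod (trig_sum a F t))\<^sup>2 \<partial>circle) = (\<Sum>m\<in>F. (cmod (a m))\<^sup>2)"
proof -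
  have "(\<lambda>_. 0) \<in> square_integrable"
    by (simp add: square_integrable_def)
  moreover have "coef (\<lambda>_. 0) m = 0" for m
    by (simp add: coef_def)
  ultimately show ?thesis
    using integral_norm_trig_sum_diff[of "\<lambda>_. 0" F a] assms by simp
qed

lemma norm_sq_trig_sum:
  "finite F \<Longrightarrow> norm_sq (trig_sum a F) = ennreal (\<Sum>m\<in>F. (cmod (a m))\<^sup>2)"
  by (simp add: norm_sq_eq square_integrable_trig_sum integral_norm_trig_sum)

lemma bessel:
  assumes g: "g \<in> square_integrable" and "finite F"
  shows "(\<Sum>m\<in>F. (cmod (coef g m))\<^sup>2) \<le> (\<integral>t. (cmod (g t))\<^sup>2 \<partial>circle)"
proof -
  have "0 \<le> (\<integral>t. (cmod (trig_sum (coef g) F t - g t))\<^sup>2 \<partial>circle)"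
    by (intro integral_nonneg_AE) auto
  then show ?thesis
    using integral_norm_trig_sum_diff[OF assms, of "coef g"] by simp
qed

lemma fourier_iff:
  "g \<in> fourier a \<longleftrightarrow> g \<in> square_integrable \<and>
    ((\<lambda>F. norm_sq (\<lambda>t. trig_sum a F t - g t)) \<longlongrightarrow> 0) (finite_subsets_at_top UNIV)"
proof -
  have "complex_of_real (1 / sqrt (2 * pi)) * (\<Sum>m\<in>F. a m * exp (- \<i> * of_int m * of_real t))
    = trig_sum a F t" for F and t :: real
    by (simp add: trig_sum_def trig_def sum_distrib_left mult_ac)
  then show ?thesis
    by (simp only: fourier_def norm_sq_def mem_Collect_eq)
qed

text \<open>Bessel's inequality at the single index \<open>m\<close> bounds
  \<open>|a m - coef g m|^2\<close> by the error of every partial sum that contains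
  \<open>m\<close>, and these errors tend to zero.\<close>

lemma coef_fourier:
  assumes "g \<in> fourier a"
  shows "coef g = a"
proof
  fix m
  have g: "g \<in> square_integrable"
    and lim: "((\<lambda>F. norm_sq (\<lambda>t. trig_sum a F t - g t)) \<longlongrightarrow> 0) (finite_subsets_at_top UNIV)"
    using assms by (auto simp: fourier_iff)
  have "ennreal ((cmod (a m - coef g m))\<^sup>2) \<le> norm_sq (\<lambda>t. trig_sum a F t - g t)"
    if "finite F" "m \<in> F" for F
  proof -
    have si: "(\<lambda>t. trig_sum a F t - g t) \<in> square_integrable"
      by (intro square_integrable_diff square_integrable_trig_sum g)
    have "coef (\<lambda>t. trig_sum a F t - g t) m = a m - coef g m"
      using that by (simp add: coef_diff integrable_square_integrable g square_integrable_trig_sum coef_trig_sum)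
    then have "(cmod (a m - coef g m))\<^sup>2 \<le> (\<integral>t. (cmod (trig_sum a F t - g t))\<^sup>2 \<partial>circle)"
      using bessel[OF si, of "{m}"] by simp
    then show ?thesis
      unfolding norm_sq_eq[OF si] by (rule ennreal_leI)
  qed
  then have "eventually (\<lambda>F. ennreal ((cmod (a m - coef g m))\<^sup>2) \<le> norm_sq (\<lambda>t. trig_sum a F t - g t))
      (finite_subsets_at_top UNIV)"
    unfolding eventually_finite_subsets_at_top by (intro exI[of _ "{m}"]) auto
  then have "ennreal ((cmod (a m - coef g m))\<^sup>2) \<le> 0"
    by (rule tendsto_lowerbound[OF lim]) simp
  then show "coef g m = a m"
    by (simp add: ennreal_eq_0_iff)
qed

lemma parseval:
  assumes "g \<in> fourier a"
  shows "norm_sq g = (\<Sum>\<^sub>\<infinity>m. ennreal ((cmod (a m))\<^sup>2))"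
proof -
  let ?T = "finite_subsets_at_top (UNIV :: int set)" and ?I = "\<integral>t. (cmod (g t))\<^sup>2 \<partial>circle"
  have g: "g \<in> square_integrable"
    and lim: "((\<lambda>F. norm_sq (\<lambda>t. trig_sum a F t - g t)) \<longlongrightarrow> 0) ?T"
    using assms by (auto simp: fourier_iff)
  have a: "coef g = a"
    by (rule coef_fourier[OF assms])
  have "eventually (\<lambda>F. norm_sq (\<lambda>t. trig_sum a F t - g t) = ennreal (?I - (\<Sum>m\<in>F. (cmod (a m))\<^sup>2))) ?T"
  proof (rule eventually_finite_subsets_at_top_weakI)
    fix F :: "int set" assume "finite F"
    then show "norm_sq (\<lambda>t. trig_sum a F t - g t) = ennreal (?I - (\<Sum>m\<in>F. (cmod (a m))\<^sup>2))"
      using integral_norm_trig_sum_diff[OF g, of F a]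
      by (simp add: norm_sq_eq square_integrable_diff square_integrable_trig_sum g a)
  qed
  then have "((\<lambda>F. ennreal (?I - (\<Sum>m\<in>F. (cmod (a m))\<^sup>2))) \<longlongrightarrow> ennreal 0) ?T"
    using lim by (simp add: tendsto_cong)
  \<comment> \<open>\<open>ennreal\<close> sends negative reals to 0, so Bessel's inequality is what
    lets the limit be read back in the reals.\<close>
  moreover have "eventually (\<lambda>F. 0 \<le> ?I - (\<Sum>m\<in>F. (cmod (a m))\<^sup>2)) ?T"
    by (rule eventually_finite_subsets_at_top_weakI) (use bessel[OF g] in \<open>simp add: a\<close>)
  ultimately have "((\<lambda>F. ?I - (\<Sum>m\<in>F. (cmod (a m))\<^sup>2)) \<longlongrightarrow> 0) ?T"
    by (subst (asm) tendsto_ennreal_iff) auto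
  then have "((\<lambda>F. ?I - (?I - (\<Sum>m\<in>F. (cmod (a m))\<^sup>2))) \<longlongrightarrow> ?I - 0) ?T"
    by (intro tendsto_intros)
  then have "((\<lambda>F. ennreal (\<Sum>m\<in>F. (cmod (a m))\<^sup>2)) \<longlongrightarrow> ennreal ?I) ?T"
    by simp
  moreover have "(\<lambda>F. ennreal (\<Sum>m\<in>F. (cmod (a m))\<^sup>2)) = sum (\<lambda>m. ennreal ((cmod (a m))\<^sup>2))"
    by (intro ext) (simp add: sum_ennreal)
  ultimately have "((\<lambda>m. ennreal ((cmod (a m))\<^sup>2)) has_sum ennreal ?I) UNIV"
    by (simp add: has_sum_def)
  then show ?thesis
    by (simp add: norm_sq_eq[OF g] infsumI)
qed

text \<open>The difference is a trigonometric sum with coefficients \<open>a\<close> up to sign on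
  the symmetric difference of \<open>F\<close> and \<open>G\<close>, which avoids \<open>H\<close>,
  and 0 elsewhere.\<close>

lemma norm_sq_trig_sum_diff_le:
  assumes "finite F" "finite G" "H \<subseteq> F" "H \<subseteq> G"
  shows "norm_sq (\<lambda>t. trig_sum a F t - trig_sum a G t) \<le> ennreal (\<Sum>m\<in>F \<union> G - H. (cmod (a m))\<^sup>2)"
proof -
  define b where "b m = (if m \<in> F then a m else 0) - (if m \<in> G then a m else 0)" for m
  have ext: "trig_sum a K t = (\<Sum>m\<in>F \<union> G. (if m \<in> K then a m else 0) * trig m t)" if "K \<subseteq> F \<union> G" for K t
    unfolding trig_sum_def using assms that by (intro sum.mono_neutral_cong_left) auto
  have "(\<lambda>t. trig_sum a F t - trig_sum a G t) = trig_sum b (F \<union> G)"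
    by (simp add: ext[of F] ext[of G] trig_sum_def[of b] b_def fun_eq_iff left_diff_distrib sum_subtractf)
  then have "norm_sq (\<lambda>t. trig_sum a F t - trig_sum a G t) = ennreal (\<Sum>m\<in>F \<union> G. (cmod (b m))\<^sup>2)"
    using assms by (simp add: norm_sq_trig_sum)
  also have "(\<Sum>m\<in>F \<union> G. (cmod (b m))\<^sup>2) = (\<Sum>m\<in>F \<union> G - H. (cmod (b m))\<^sup>2)"
    using assms by (intro sum.mono_neutral_right) (auto simp: b_def)
  also have "\<dots> \<le> (\<Sum>m\<in>F \<union> G - H. (cmod (a m))\<^sup>2)"
    by (intro sum_mono power_mono) (auto simp: b_def)
  finally show ?thesis
    by (simp add: ennreal_leI)
qed

text \<open>Fatou's lemma for squared norms; it carries tail bounds for partial sums over to their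
  pointwise limit.\<close>

lemma norm_sq_le_of_tendsto:
  assumes [measurable]: "\<And>k. h k \<in> borel_measurable circle"
    and lim: "AE t in circle. (\<lambda>k. h k t) \<longlonglongrightarrow> l t"
    and le: "eventually (\<lambda>k. norm_sq (h k) \<le> C) sequentially"
  shows "norm_sq l \<le> C"
proof -
  have "norm_sq l = (\<integral>\<^sup>+t. liminf (\<lambda>k. ennreal ((cmod (h k t))\<^sup>2)) \<partial>circle)"
    unfolding norm_sq_def
  proof (rule nn_integral_cong_AE, use lim in eventually_elim)
    case (elim t)
    then have "(\<lambda>k. ennreal ((cmod (h k t))\<^sup>2)) \<longlonglongrightarrow> ennreal ((cmod (l t))\<^sup>2)"
      by (intro tendsto_intros)
    then show ?case
      by (simp only: lim_imp_Liminf[OF sequentially_bot])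
  qed
  also have "\<dots> \<le> liminf (\<lambda>k. norm_sq (h k))"
    unfolding norm_sq_def by (rule nn_integral_liminf) measurable
  also have "\<dots> \<le> C"
    by (intro Liminf_le le) simp
  finally show ?thesis .
qed

text \<open>Choose \<open>G\<close> whose sum is within \<open>e\<close> of the total; adding a
  disjoint finite set cannot exceed the total.\<close>

lemma summable_on_cofinite_tail:
  fixes f :: "'a \<Rightarrow> real"
  assumes "f summable_on UNIV" and nonneg: "\<And>x. 0 \<le> f x" and "e > 0"
  obtains G where "finite G" "\<And>F. finite F \<Longrightarrow> F \<inter> G = {} \<Longrightarrow> sum f F < e"
proof -
  have lim: "(sum f \<longlongrightarrow> infsum f UNIV) (finite_subsets_at_top UNIV)"
    using infsum_tendsto[OF assms(1)] .
  then have "eventually (\<lambda>G. infsum f UNIV - e < sum f G) (finite_subsets_at_top UNIV)"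
    by (rule order_tendstoD) (use \<open>e > 0\<close> in simp)
  then obtain G where G: "finite G" "infsum f UNIV - e < sum f G"
    unfolding eventually_finite_subsets_at_top by blast
  show thesis
  proof (rule that[OF G(1)])
    fix F assume F: "finite F" "F \<inter> G = {}"
    have "sum f (F \<union> G) \<le> infsum f UNIV"
      using F G by (intro finite_sum_le_infsum assms(1)) (auto simp: nonneg)
    then show "sum f F < e"
      using F G by (simp add: sum.union_disjoint)
  qed
qed

text \<open>A weighted AM-GM bound. With \<open>c = 2 ^ k\<close> it deduces absolute convergence of
  a series from convergence of its squares weighted by \<open>2 ^ k\<close>.\<close>

lemma abs_le_weighted_square:
  fixes x c :: real
  assumes "c > 0"
  shows "x \<le> 1 / c + c * x\<^sup>2"
proof -
  have "0 \<le> (c * x - 1)\<^sup>2 + (c * x)\<^sup>2 + 1" by simp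
  then have "2 * (c * x) \<le> 2 * (1 + (c * x)\<^sup>2)" by (simp add: power2_eq_square algebra_simps)
  then have "c * x \<le> c * (1 / c + c * x\<^sup>2)"
    using assms by (simp add: power2_eq_square algebra_simps)
  then show ?thesis using assms by simp
qed

text \<open>A rapidly converging sequence of partial sums converges almost everywhere. Its pointwise
  limit then turns out to be the L2 limit over all finite index sets, not only along the
  sequence.\<close>

lemma riesz_fischer:
  assumes "(\<lambda>m. (cmod (a m))\<^sup>2) summable_on UNIV"
  obtains g where "g \<in> fourier a"
proof -
  let ?w = "\<lambda>m. (cmod (a m))\<^sup>2"
  \<comment> \<open>The rate \<open>(1 / 4) ^ k\<close> beats the weight \<open>2 ^ k\<close> used
    below and leaves the summable \<open>(1 / 2) ^ k\<close>.\<close>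
  have "\<exists>G. finite G \<and> (\<forall>F. finite F \<longrightarrow> F \<inter> G = {} \<longrightarrow> sum ?w F < (1 / 4) ^ k)" for k :: nat
    by (rule summable_on_cofinite_tail[OF assms, of "(1 / 4) ^ k"]) auto
  then obtain G where finG: "\<And>k. finite (G k)"
    and G: "\<And>k F. finite F \<Longrightarrow> F \<inter> G k = {} \<Longrightarrow> sum ?w F < (1 / 4) ^ k"
    by metis
  \<comment> \<open>The unions make the index sets nested, so the bound at level \<open>j\<close>
    applies to \<open>S k\<close> for every \<open>k \<ge> j\<close>.\<close>
  define A where "A k = (\<Union>j\<le>k. G j)" for k
  have finA: "finite (A k)" for k
    using finG by (simp add: A_def)
  have A_mono: "A j \<subseteq> A k" if "j \<le> k" for j k
    using that by (fastforce simp: A_def)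
  have tail: "norm_sq (\<lambda>t. trig_sum a F t - trig_sum a K t) \<le> ennreal ((1 / 4) ^ j)"
    if "finite F" "finite K" "A j \<subseteq> F" "A j \<subseteq> K" for F K j
  proof -
    have "norm_sq (\<lambda>t. trig_sum a F t - trig_sum a K t) \<le> ennreal (sum ?w (F \<union> K - A j))"
      using that by (intro norm_sq_trig_sum_diff_le)
    also have "\<dots> \<le> ennreal ((1 / 4) ^ j)"
    proof (intro ennreal_leI less_imp_le G)
      show "(F \<union> K - A j) \<inter> G j = {}"
        by (auto simp: A_def)
    qed (use that in auto)
    finally show ?thesis .
  qed
  define S where "S k = trig_sum a (A k)" for k
  have [measurable]: "S k \<in> borel_measurable circle" for k
    by (simp add: S_def)
  define d where "d k t = cmod (S (Suc k) t - S k t)" for k t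
  have [measurable]: "d k \<in> borel_measurable circle" for k
    unfolding d_def by measurable
  \<comment> \<open>The weighted squares of the increments have a finite integral, hence a finite
    sum almost everywhere; there the telescoping series of the increments converges
    absolutely.\<close>
  have "(\<integral>\<^sup>+t. (\<Sum>k. ennreal (2 ^ k * (d k t)\<^sup>2)) \<partial>circle) = (\<Sum>k. \<integral>\<^sup>+t. ennreal (2 ^ k * (d k t)\<^sup>2) \<partial>circle)"
    by (rule nn_integral_suminf) measurable
  also have "\<dots> \<le> (\<Sum>k. ennreal ((1 / 2) ^ k))"
  proof (intro suminf_le summableI)
    fix k
    have "(\<integral>\<^sup>+t. ennreal (2 ^ k * (d k t)\<^sup>2) \<partial>circle) = ennreal (2 ^ k) * norm_sq (\<lambda>t. S (Suc k) t - S k t)"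
      by (simp add: norm_sq_def d_def ennreal_mult nn_integral_cmult)
    also have "\<dots> \<le> ennreal (2 ^ k) * ennreal ((1 / 4) ^ k)"
      unfolding S_def using finA A_mono[of k "Suc k"] by (intro mult_left_mono tail) auto
    also have "\<dots> = ennreal ((1 / 2) ^ k)"
      by (simp add: ennreal_mult [symmetric] power_mult_distrib [symmetric])
    finally show "(\<integral>\<^sup>+t. ennreal (2 ^ k * (d k t)\<^sup>2) \<partial>circle) \<le> ennreal ((1 / 2) ^ k)" .
  qed
  also have "\<dots> < \<infinity>"
    by (subst suminf_ennreal2) (auto intro: summable_geometric)
  finally have "AE t in circle. (\<Sum>k. ennreal (2 ^ k * (d k t)\<^sup>2)) \<noteq> \<infinity>"
    by (intro nn_integral_noteq_infinite) auto
  then have "AE t in circle. convergent (\<lambda>k. S k t)"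
  proof eventually_elim
    case (elim t)
    have "summable (\<lambda>k. 2 ^ k * (d k t)\<^sup>2)"
      using elim by (intro summable_suminf_not_top) auto
    then have "summable (\<lambda>k. 1 / 2 ^ k + 2 ^ k * (d k t)\<^sup>2)"
      using summable_geometric[of "1 / 2 :: real"] by (intro summable_add) (auto simp: power_one_over)
    then have "summable (\<lambda>k. S (Suc k) t - S k t)"
      by (rule summable_comparison_test')
        (use abs_le_weighted_square in \<open>auto simp: d_def [symmetric]\<close>)
    then show ?case
      using sum_lessThan_telescope[of "\<lambda>k. S k t"]
      by (simp add: summable_iff_convergent convergent_diff_const_right_iff)
  qed
  then have lim: "AE t in circle. (\<lambda>k. S k t) \<longlonglongrightarrow> lim (\<lambda>k. S k t)"
    by eventually_elim (simp add: convergent_LIMSEQ_iff)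
  define g where "g t = lim (\<lambda>k. S k t)" for t
  have [measurable]: "g \<in> borel_measurable circle"
    unfolding g_def by measurable
  \<comment> \<open>The set \<open>F\<close> stays fixed while \<open>S k\<close> tends to
    \<open>g\<close>. This gives the bound for every finite superset of \<open>A j\<close>, as the
    limit over finite sets requires.\<close>
  have bound: "norm_sq (\<lambda>t. trig_sum a F t - g t) \<le> ennreal ((1 / 4) ^ j)"
    if "finite F" "A j \<subseteq> F" for F j
  proof (rule norm_sq_le_of_tendsto)
    show "AE t in circle. (\<lambda>k. trig_sum a F t - S k t) \<longlonglongrightarrow> trig_sum a F t - g t"
      using lim by eventually_elim (auto simp: g_def intro!: tendsto_intros)
    show "eventually (\<lambda>k. norm_sq (\<lambda>t. trig_sum a F t - S k t) \<le> ennreal ((1 / 4) ^ j)) sequentially"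
      using eventually_ge_at_top[of j]
      by eventually_elim (unfold S_def, intro tail that finA A_mono)
  qed measurable
  \<comment> \<open>The bound at level 0 is finite, and \<open>g\<close> is \<open>S 0\<close> minus
    this difference.\<close>
  have "(\<lambda>t. S 0 t - g t) \<in> square_integrable"
    using le_less_trans[OF bound[OF finA order_refl, of 0]]
    by (simp add: square_integrable_iff S_def)
  then have "(\<lambda>t. S 0 t - (S 0 t - g t)) \<in> square_integrable"
    by (rule square_integrable_diff[rotated]) (simp add: S_def square_integrable_trig_sum)
  then have g: "g \<in> square_integrable"
    by simp
  have "((\<lambda>F. norm_sq (\<lambda>t. trig_sum a F t - g t)) \<longlongrightarrow> 0) (finite_subsets_at_top UNIV)"
  proof (rule order_tendstoI)
    fix e :: ennreal assume "0 < e"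
    have "(\<lambda>j. ennreal ((1 / 4) ^ j)) \<longlonglongrightarrow> ennreal 0"
      by (intro tendsto_ennrealI LIMSEQ_power_zero) simp
    then have "eventually (\<lambda>j. ennreal ((1 / 4) ^ j) < e) sequentially"
      using \<open>0 < e\<close> by (intro order_tendstoD) auto
    then obtain j where j: "ennreal ((1 / 4) ^ j) < e"
      by (auto simp: eventually_sequentially)
    show "eventually (\<lambda>F. norm_sq (\<lambda>t. trig_sum a F t - g t) < e) (finite_subsets_at_top UNIV)"
      unfolding eventually_finite_subsets_at_top using bound j finA
      by (intro exI[of _ "A j"]) (auto intro: le_less_trans)
  qed simp
  with g show thesis
    by (intro that) (simp add: fourier_iff)
qed

section \<open>Completeness of the trigonometric system\<close>

lemma integrable_mult_bounded_circle:
  fixes g u :: "real \<Rightarrow> complex"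
  assumes g: "integrable circle g" and u: "u \<in> borel_measurable circle"
    "\<And>t. cmod (u t) \<le> C"
  shows "integrable circle (\<lambda>t. g t * u t)"
proof (rule Bochner_Integration.integrable_bound)
  show "integrable circle (\<lambda>t. of_real C * g t)"
    using g by simp
  have "0 \<le> C"
    using u(2)[of 0] norm_ge_zero order_trans by blast
  then show "AE t in circle. norm (g t * u t) \<le> norm (of_real C * g t)"
    using u(2) by (intro always_eventually allI)
      (metis norm_mult mult.commute mult_right_mono norm_ge_zero norm_of_real abs_of_nonneg)
qed (use g u in simp)

text \<open>A coordinate function on the circle is a combination of e^(it) and e^(-it), which only
  shift the vanishing coefficients. The induction keeps \<open>g\<close> arbitrary because a product
  of polynomials is absorbed one factor at a time.\<close>

lemma coef_polynomial_zero:
  assumes "real_polynomial_function p" "integrable circle g" "\<And>m. coef g m = 0"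
  shows "integrable circle (\<lambda>t. g t * of_real (p (cis t))) \<and> (\<forall>m. coef (\<lambda>t. g t * of_real (p (cis t))) m = 0)"
  using assms
proof (induction p arbitrary: g rule: real_polynomial_function.induct)
  case (linear f)
  define e where "e k t = exp (\<i> * of_int k * of_real t)" for k :: int and t :: real
  \<comment> \<open>Euler's formulas for \<open>cos t * f 1 + sin t * f \<i>\<close>, the value of
    the real linear \<open>f\<close> at \<open>cis t\<close>.\<close>
  define \<alpha> \<beta> where "\<alpha> = (of_real (f 1) - \<i> * of_real (f \<i>)) / 2" and "\<beta> = (of_real (f 1) + \<i> * of_real (f \<i>)) / 2"
  have e_int: "integrable circle (\<lambda>t. e k t * g t)" for k
  proof -
    have "e k \<in> borel_measurable circle"
      unfolding e_def by (intro continuous_imp_measurable_circle continuous_intros)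
    moreover have "cmod (e k t) \<le> 1" for t
      by (simp add: e_def norm_exp_eq_Re)
    ultimately have "integrable circle (\<lambda>t. g t * e k t)"
      by (rule integrable_mult_bounded_circle[OF linear.prems(1)])
    then show ?thesis
      by (simp only: mult.commute)
  qed
  have eq: "g t * of_real (f (cis t)) = \<alpha> * (e 1 t * g t) + \<beta> * (e (- 1) t * g t)" for t
  proof -
    interpret f: bounded_linear f by fact
    have "cis t = cos t *\<^sub>R 1 + sin t *\<^sub>R \<i>"
      by (simp add: complex_eq_iff)
    then have f: "f (cis t) = cos t * f 1 + sin t * f \<i>"
      by (simp only: f.add f.scaleR) simp
    have e: "e 1 t = of_real (cos t) + \<i> * of_real (sin t)" "e (- 1) t = of_real (cos t) - \<i> * of_real (sin t)"
      by (simp_all add: e_def complex_eq_iff Re_exp Im_exp)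
    show ?thesis
      unfolding f e \<alpha>_def \<beta>_def by (simp add: field_simps)
  qed
  have "coef (\<lambda>t. \<alpha> * (e 1 t * g t) + \<beta> * (e (- 1) t * g t)) m = 0" for m
    using coef_mult_exp[of 1 g m] coef_mult_exp[of "- 1" g m] linear.prems(2)
    by (subst coef_add) (simp_all add: coef_cmult e_int, simp add: e_def)
  then show ?case
    unfolding eq using e_int by simp
next
  case (const c)
  then show ?case
    using coef_cmult[of "of_real c" g] by (simp add: mult.commute)
next
  case (add f h)
  then show ?case
    by (simp add: distrib_left coef_add)
next
  case (mult f h)
  have "integrable circle (\<lambda>t. g t * of_real (f (cis t))) \<and> (\<forall>m. coef (\<lambda>t. g t * of_real (f (cis t))) m = 0)"
    using mult by blast
  then show ?case
    using mult.IH(2)[of "\<lambda>t. g t * of_real (f (cis t))"] by (simp add: mult.assoc)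
qed

lemma integral_eq_coef_0: "(\<integral>t. g t \<partial>circle) = of_real (sqrt (2 * pi)) * coef g 0"
  by (simp add: coef_def trig_def)

lemma continuous_on_cis: "continuous_on A cis"
  unfolding cis_conv_exp by (intro continuous_intros)

text \<open>By Stone-Weierstrass, \<phi> is uniformly within \<open>e\<close> of a polynomial in the
  two real coordinates. The polynomial integrates to zero against \<open>g\<close>, so the integral
  is at most \<open>e\<close> times the L1 norm of \<open>g\<close>.\<close>

lemma integral_continuous_circle_zero:
  fixes \<phi> :: "complex \<Rightarrow> complex"
  assumes g: "integrable circle g" "\<And>m. coef g m = 0" and \<phi>: "continuous_on (sphere 0 1) \<phi>"
  shows "(\<integral>t. g t * \<phi> (cis t) \<partial>circle) = 0"
proof -
  have m: "(\<lambda>t. \<psi> (cis t)) \<in> borel_measurable circle" if "continuous_on (sphere 0 1) \<psi>" for \<psi> :: "complex \<Rightarrow> complex"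
    by (intro continuous_imp_measurable_circle continuous_on_compose2[OF that continuous_on_cis]) auto
  have int: "integrable circle (\<lambda>t. g t * \<psi> (cis t))" if \<psi>: "continuous_on (sphere 0 1) \<psi>" for \<psi> :: "complex \<Rightarrow> complex"
  proof -
    have "bounded (\<psi> ` sphere 0 1)"
      by (intro compact_imp_bounded compact_continuous_image \<psi>) simp
    then obtain C where "\<And>z. z \<in> sphere 0 1 \<Longrightarrow> cmod (\<psi> z) \<le> C"
      unfolding bounded_iff by blast
    then show ?thesis
      by (intro integrable_mult_bounded_circle[where C = C] g m \<psi>) simp
  qed
  let ?G = "\<integral>t. cmod (g t) \<partial>circle"
  have le: "cmod (\<integral>t. g t * \<phi> (cis t) \<partial>circle) \<le> e * ?G" if e: "e > 0" for e
  proof -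
    obtain p where p: "polynomial_function p" "\<And>z. z \<in> sphere 0 1 \<Longrightarrow> cmod (\<phi> z - p z) < e"
      using Stone_Weierstrass_polynomial_function[OF compact_sphere \<phi> e] by blast
    have pc: "continuous_on (sphere 0 1) p"
      using p(1) by (rule continuous_on_polymonial_function)
    have "real_polynomial_function (\<lambda>z. Re (p z))" "real_polynomial_function (\<lambda>z. Im (p z))"
      using p(1) bounded_linear_Re bounded_linear_Im by (auto simp: polynomial_function_def o_def)
    note re = coef_polynomial_zero[OF this(1) g] and im = coef_polynomial_zero[OF this(2) g]
    have "g t * p (cis t) = g t * of_real (Re (p (cis t))) + \<i> * (g t * of_real (Im (p (cis t))))" for t
      by (subst complex_eq[of "p (cis t)"]) (simp add: algebra_simps)
    then have "(\<integral>t. g t * p (cis t) \<partial>circle) = 0"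
      using re im by (simp add: integral_eq_coef_0 coef_add coef_cmult)
    then have "(\<integral>t. g t * \<phi> (cis t) \<partial>circle) = (\<integral>t. g t * (\<phi> (cis t) - p (cis t)) \<partial>circle)"
      using int[OF \<phi>] int[OF pc] by (simp add: right_diff_distrib)
    also have "cmod \<dots> \<le> (\<integral>t. e * cmod (g t) \<partial>circle)"
    proof (rule Bochner_Integration.integral_norm_bound_integral)
      show "integrable circle (\<lambda>t. g t * (\<phi> (cis t) - p (cis t)))"
        using int[of "\<lambda>z. \<phi> z - p z"] \<phi> pc by (simp add: continuous_on_diff)
      show "integrable circle (\<lambda>t. e * cmod (g t))"
        using g by simp
      fix t
      show "cmod (g t * (\<phi> (cis t) - p (cis t))) \<le> e * cmod (g t)"
        using mult_left_mono[of "cmod (\<phi> (cis t) - p (cis t))" e "cmod (g t)"] p(2)[of "cis t"]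
        by (simp add: norm_mult mult.commute[of e])
    qed
    finally show ?thesis by simp
  qed
  have "((\<lambda>e. e * ?G) \<longlongrightarrow> 0 * ?G) (at_right 0)"
    by (rule tendsto_mult[OF tendsto_ident_at tendsto_const])
  moreover have "eventually (\<lambda>e. cmod (\<integral>t. g t * \<phi> (cis t) \<partial>circle) \<le> e * ?G) (at_right 0)"
    using le by (auto simp: eventually_at_right_field intro: exI[of _ 1])
  ultimately have "cmod (\<integral>t. g t * \<phi> (cis t) \<partial>circle) \<le> 0 * ?G"
    by (rule tendsto_lowerbound) simp
  then show ?thesis by simp
qed

text \<open>The cut-off factor vanishes at \<open>-1\<close>, where \<open>Arg\<close> jumps.\<close>

lemma continuous_on_cutoff_Arg:
  fixes h :: "real \<Rightarrow> complex"
  assumes h: "continuous_on UNIV h" and le: "\<And>t. cmod (h t) \<le> 1"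
  shows "continuous_on (sphere 0 1) (\<lambda>z. of_real (min 1 (c * (1 + Re z))) * h (Arg z))"
    (is "continuous_on _ ?\<phi>")
  unfolding continuous_on_eq_continuous_within
proof
  fix z :: complex assume z: "z \<in> sphere 0 1"
  show "continuous (at z within sphere 0 1) ?\<phi>"
  proof (cases "z = - 1")
    case True
    have "((\<lambda>w. complex_of_real (min 1 (c * (1 + Re w)))) \<longlongrightarrow> of_real (min 1 (c * (1 + Re z)))) (at z within sphere 0 1)"
      by (intro tendsto_intros)
    then have lim: "((\<lambda>w. complex_of_real (min 1 (c * (1 + Re w)))) \<longlongrightarrow> 0) (at z within sphere 0 1)"
      using True by simp
    have "cmod (?\<phi> w) \<le> cmod (complex_of_real (min 1 (c * (1 + Re w)))) " for w
      unfolding norm_mult using le by (intro mult_left_le) auto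
    then have "(?\<phi> \<longlongrightarrow> 0) (at z within sphere 0 1)"
      by (intro Lim_null_comparison[OF _ tendsto_norm_zero[OF lim]] always_eventually allI)
    then show ?thesis
      using True by (simp add: continuous_within)
  next
    case False
    have "z \<notin> \<real>\<^sub>\<le>\<^sub>0"
    proof
      assume "z \<in> \<real>\<^sub>\<le>\<^sub>0"
      then obtain r where r: "z = of_real r" "r \<le> 0"
        by (auto elim: nonpos_Reals_cases)
      with z have "r = - 1" by simp
      with r False show False by simp
    qed
    then have "continuous (at z) Arg"
      by (rule continuous_at_Arg)
    moreover have "continuous (at (Arg z)) h"
      using h by (simp add: continuous_on_eq_continuous_at)
    ultimately have "continuous (at z) (\<lambda>w. h (Arg w))"
      using continuous_at_compose[of z Arg h] by (simp add: o_def)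
    then have "continuous (at z) ?\<phi>"
      by (intro continuous_intros linear_continuous_at[OF bounded_linear_Re])
    then show ?thesis
      by (rule continuous_at_imp_continuous_at_within)
  qed
qed

lemma AE_circle_not_in:
  assumes "negligible N"
  shows "AE t in circle. t \<notin> N"
proof -
  have "AE t in lebesgue. t \<notin> N"
    using assms by (intro AE_not_in) (simp add: negligible_iff_null_sets)
  then show ?thesis
    by (subst AE_restrict_space_iff) auto
qed

text \<open>Testing \<open>g\<close> against \<open>cnj (sgn (g t))\<close> would give its L1 norm.
  This test function is only measurable, so it is approximated almost everywhere by continuous
  functions on the circle, for which the integral vanishes; dominated convergence finishes.\<close>

lemma coef_zero_imp_AE_zero:
  assumes g: "integrable circle g" "\<And>m. coef g m = 0"
  shows "AE t in circle. g t = 0"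
proof -
  have "(\<lambda>t. cnj (sgn (g t))) \<in> borel_measurable circle"
    by (rule borel_measurable_continuous_on[OF linear_continuous_on[OF bounded_linear_cnj]]) (use g in simp)
  then have "(\<lambda>t. cnj (sgn (g t))) measurable_on {-pi..pi}"
    by (simp add: measurable_on_iff_borel_measurable)
  then obtain N h where N: "negligible N" and h: "\<And>k::nat. continuous_on UNIV (h k)"
    and lim: "\<And>t. t \<notin> N \<Longrightarrow> (\<lambda>k. h k t) \<longlonglongrightarrow> (if t \<in> {-pi..pi} then cnj (sgn (g t)) else 0)"
    unfolding measurable_on_def by blast
  \<comment> \<open>Clipping to the unit disc keeps continuity, supplies the bound for dominated
    convergence and preserves the limit, whose modulus is at most 1.\<close>
  define u where "u k t = h k t / of_real (max 1 (cmod (h k t)))" for k t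
  have u: "continuous_on UNIV (u k)" for k
    unfolding u_def using h by (intro continuous_intros) (auto simp: max_def)
  have u_le: "cmod (u k t) \<le> 1" for k t
    by (simp add: u_def norm_divide max_def)
  \<comment> \<open>For each \<open>t\<close> strictly between -pi and pi, \<open>1 + cos t\<close>
    is positive, so the cut-off equals 1 for all large \<open>k\<close>.\<close>
  define \<phi> where "\<phi> k z = complex_of_real (min 1 (real k * (1 + Re z))) * u k (Arg z)" for k z
  have \<phi>: "continuous_on (sphere 0 1) (\<phi> k)" for k
    unfolding \<phi>_def by (intro continuous_on_cutoff_Arg u u_le)
  have \<phi>_le: "cmod (\<phi> k (cis t)) \<le> 1" for k t
  proof -
    have "0 \<le> real k * (1 + Re (cis t))"
    proof -
      have "0 \<le> 1 + cos t"
        using cos_ge_minus_one[of t] by linarith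
      then show ?thesis by simp
    qed
    then have "\<bar>min 1 (real k * (1 + Re (cis t)))\<bar> \<le> 1"
      by simp
    then show ?thesis
      unfolding \<phi>_def norm_mult norm_of_real using u_le by (intro mult_le_one) auto
  qed
  have "(\<lambda>k. \<integral>t. g t * \<phi> k (cis t) \<partial>circle) \<longlonglongrightarrow> (\<integral>t. of_real (cmod (g t)) \<partial>circle)"
  proof (rule integral_dominated_convergence)
    show "AE t in circle. (\<lambda>k. g t * \<phi> k (cis t)) \<longlonglongrightarrow> of_real (cmod (g t))"
    proof -
      have "negligible (N \<union> {-pi, pi})"
        using N by (simp add: negligible_Un)
      then have "AE t in circle. t \<notin> N \<union> {-pi, pi}"
        by (rule AE_circle_not_in)
      moreover have "AE t in circle. t \<in> {-pi..pi}"
        by (rule AE_I2) simp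
      ultimately show ?thesis
      proof eventually_elim
        case (elim t)
        then have t: "-pi < t" "t < pi" "t \<notin> N" by auto
        have "(\<lambda>k. u k t) \<longlonglongrightarrow> cnj (sgn (g t)) / of_real (max 1 (cmod (cnj (sgn (g t)))))"
          unfolding u_def using lim[OF t(3)] t by (intro tendsto_intros) (auto simp: max_def)
        moreover have "max 1 (cmod (cnj (sgn (g t)))) = 1"
          by (simp add: norm_sgn)
        ultimately have ul: "(\<lambda>k. u k t) \<longlonglongrightarrow> cnj (sgn (g t))"
          by simp
        have "cos t > - 1"
          using cos_monotone_0_pi[of "\<bar>t\<bar>" pi] t by simp
        then have "filterlim (\<lambda>k. real k * (1 + cos t)) at_top sequentially"
          by (intro filterlim_at_top_mult_tendsto_pos[OF tendsto_const] filterlim_real_sequentially) simp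
        then have "eventually (\<lambda>k. 1 \<le> real k * (1 + cos t)) sequentially"
          by (simp add: filterlim_at_top)
        then have "eventually (\<lambda>k. u k t = \<phi> k (cis t)) sequentially"
          by eventually_elim (use t in \<open>simp add: \<phi>_def Arg_cis\<close>)
        then have "(\<lambda>k. \<phi> k (cis t)) \<longlonglongrightarrow> cnj (sgn (g t))"
          using ul by (rule Lim_transform_eventually[rotated])
        then have "(\<lambda>k. g t * \<phi> k (cis t)) \<longlonglongrightarrow> g t * cnj (sgn (g t))"
          by (intro tendsto_intros)
        moreover have "g t * cnj (sgn (g t)) = of_real (cmod (g t))"
        proof (cases "g t = 0")
          case False
          have "g t * cnj (sgn (g t)) = g t * cnj (g t) / of_real (cmod (g t))"
            by (simp add: sgn_eq)
          also have "\<dots> = of_real (cmod (g t))"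
            using False by (simp add: complex_norm_square [symmetric] power2_eq_square)
          finally show ?thesis .
        qed simp
        ultimately show ?case by simp
      qed
    qed
    show "AE t in circle. norm (g t * \<phi> k (cis t)) \<le> cmod (g t)" for k
      using \<phi>_le by (intro always_eventually allI) (simp add: norm_mult mult_left_le)
    show "(\<lambda>t. g t * \<phi> k (cis t)) \<in> borel_measurable circle" for k
    proof -
      have "(\<lambda>t. \<phi> k (cis t)) \<in> borel_measurable circle"
        by (intro continuous_imp_measurable_circle continuous_on_compose2[OF \<phi> continuous_on_cis]) auto
      then show ?thesis
        using g by simp
    qed
  qed (use g in auto)
  then have "(\<integral>t. complex_of_real (cmod (g t)) \<partial>circle) = 0"
    unfolding integral_continuous_circle_zero[OF g \<phi>] by (simp add: LIMSEQ_const_iff)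
  then have "(\<integral>t. cmod (g t) \<partial>circle) = 0"
    by simp
  then show ?thesis
    using g by (subst (asm) integral_nonneg_eq_0_iff_AE) auto
qed

text \<open>Riesz-Fischer gives some \<open>h\<close> with the coefficients of \<open>g\<close>;
  completeness puts \<open>g\<close> and \<open>h\<close> in the same class.\<close>

lemma fourier_coef:
  assumes g: "g \<in> square_integrable"
  shows "g \<in> fourier (coef g)"
proof -
  have "(\<lambda>m. (cmod (coef g m))\<^sup>2) summable_on UNIV"
    by (rule nonneg_bdd_above_summable_on)
      (auto intro!: bdd_aboveI2[of _ _ "\<integral>t. (cmod (g t))\<^sup>2 \<partial>circle"] bessel g)
  then obtain h where h: "h \<in> fourier (coef g)"
    by (rule riesz_fischer)
  have h_si: "h \<in> square_integrable"
    using h by (simp add: fourier_iff)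
  have "AE t in circle. g t - h t = 0"
  proof (rule coef_zero_imp_AE_zero)
    show "integrable circle (\<lambda>t. g t - h t)"
      using g h_si by (simp add: integrable_square_integrable)
    show "coef (\<lambda>t. g t - h t) m = 0" for m
      using g h_si coef_fourier[OF h] by (simp add: coef_diff integrable_square_integrable)
  qed
  then have "g \<in> L2_class h"
    using g by (simp add: L2_class_def)
  then show ?thesis
    using fourier_eq_L2_class[OF h] by simp
qed

section \<open>The Bergman space\<close>

definition num :: "real \<Rightarrow> complex" where
  "num t = 1 + \<i> * exp (\<i> * of_real t)"

definition den :: "real \<Rightarrow> complex" where
  "den t = exp (\<i> * of_real t) + \<i>"

lemma num_measurable [measurable]: "num \<in> borel_measurable circle"
  and den_measurable [measurable]: "den \<in> borel_measurable circle"
  unfolding num_def den_def by (intro continuous_imp_measurable_circle continuous_intros)+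

lemma cmod_num_sq: "(cmod (num t))\<^sup>2 = 2 * (1 - sin t)"
  and cmod_den_sq: "(cmod (den t))\<^sup>2 = 2 * (1 + sin t)"
proof -
  have "Re (num t) = 1 - sin t" "Im (num t) = cos t" "Re (den t) = cos t" "Im (den t) = 1 + sin t"
    by (simp_all add: num_def den_def Re_exp Im_exp)
  then show "(cmod (num t))\<^sup>2 = 2 * (1 - sin t)" "(cmod (den t))\<^sup>2 = 2 * (1 + sin t)"
    using sin_cos_squared_add[of t] by (simp_all add: cmod_power2 power2_sum power2_diff)
qed

lemma cmod_num_le: "cmod (num t) \<le> 2" and cmod_den_le: "cmod (den t) \<le> 2"
  using norm_triangle_ineq[of 1 "\<i> * exp (\<i> * of_real t)"] norm_triangle_ineq[of "exp (\<i> * of_real t)" \<i>]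
  by (simp_all add: num_def den_def norm_mult norm_exp_eq_Re)

lemma square_integrable_num: "g \<in> square_integrable \<Longrightarrow> (\<lambda>t. num t * g t) \<in> square_integrable"
  and square_integrable_den: "g \<in> square_integrable \<Longrightarrow> (\<lambda>t. den t * g t) \<in> square_integrable"
  unfolding mult.commute[of _ "g _"]
  by (auto intro!: square_integrable_mult_bounded cmod_num_le cmod_den_le)

lemma square_integrable_exp:
  assumes "g \<in> square_integrable"
  shows "(\<lambda>t. exp (\<i> * of_real t) * g t) \<in> square_integrable"
proof -
  have "(\<lambda>t. exp (\<i> * complex_of_real t)) \<in> borel_measurable circle"
    by (intro continuous_imp_measurable_circle continuous_intros)
  then have "(\<lambda>t. g t * exp (\<i> * of_real t)) \<in> square_integrable"
    by (rule square_integrable_mult_bounded[OF assms, of _ 1]) (simp add: norm_exp_eq_Re)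
  then show ?thesis by (simp only: mult.commute)
qed

lemma coef_num:
  assumes "g \<in> square_integrable"
  shows "coef (\<lambda>t. num t * g t) m = coef g m + \<i> * coef g (m + 1)"
proof -
  have "num t * g t = g t + \<i> * (exp (\<i> * of_real t) * g t)" for t
    by (simp add: num_def algebra_simps)
  then show ?thesis
    using coef_mult_exp[of 1 g m] assms
    by (simp add: coef_add coef_cmult integrable_square_integrable square_integrable_cmult square_integrable_exp)
qed

lemma coef_den:
  assumes "g \<in> square_integrable"
  shows "coef (\<lambda>t. den t * g t) m = coef g (m + 1) + \<i> * coef g m"
proof -
  have "den t * g t = exp (\<i> * of_real t) * g t + \<i> * g t" for t
    by (simp add: den_def algebra_simps)
  then show ?thesis
    using coef_mult_exp[of 1 g m] assms
    by (simp add: coef_add coef_cmult integrable_square_integrable square_integrable_cmult square_integrable_exp)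
qed

lemma AE_eq_of_coef_eq:
  assumes "g \<in> square_integrable" "h \<in> square_integrable" "coef g = coef h"
  shows "AE t in circle. g t = h t"
proof -
  have "g \<in> fourier (coef h)" "h \<in> fourier (coef h)"
    using fourier_coef assms by metis+
  then show ?thesis
    using fourier_eq_L2_class by (fastforce simp: L2_class_def)
qed

text \<open>For fixed \<open>n\<close> the equations for all \<open>m\<close> say that two square
  integrable functions have equal coefficients, hence agree almost everywhere. There are countably
  many rows, so one null set serves them all.\<close>

lemma discrete_holomorphic_iff_AE:
  assumes g: "\<And>n. g n \<in> square_integrable" and f: "\<And>m n. f m n = coef (g n) m"
  shows "discrete_holomorphic f \<longleftrightarrow> (AE t in circle. \<forall>n. num t * g n t = den t * g (Suc n) t)"
proof -
  have eq: "f m n + \<i> * f (m + 1) n - f (m + 1) (n + 1) - \<i> * f m (n + 1) = 0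
      \<longleftrightarrow> coef (\<lambda>t. num t * g n t) m = coef (\<lambda>t. den t * g (Suc n) t) m" for m n
    by (simp add: coef_num coef_den g f diff_diff_eq)
  have "(\<forall>m. coef (\<lambda>t. num t * g n t) m = coef (\<lambda>t. den t * g (Suc n) t) m)
      \<longleftrightarrow> (AE t in circle. num t * g n t = den t * g (Suc n) t)" for n
  proof
    assume "\<forall>m. coef (\<lambda>t. num t * g n t) m = coef (\<lambda>t. den t * g (Suc n) t) m"
    then show "AE t in circle. num t * g n t = den t * g (Suc n) t"
      by (intro AE_eq_of_coef_eq square_integrable_num square_integrable_den g) auto
  next
    assume "AE t in circle. num t * g n t = den t * g (Suc n) t"
    then show "\<forall>m. coef (\<lambda>t. num t * g n t) m = coef (\<lambda>t. den t * g (Suc n) t) m"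
      using g by (subst coef_cong_AE[where h = "\<lambda>t. den t * g (Suc n) t"])
        (auto intro: square_integrable_measurable square_integrable_num square_integrable_den)
  qed
  then show ?thesis
    unfolding discrete_holomorphic_def eq AE_all_countable by blast
qed

section \<open>The geometric series in the row index\<close>

definition decay :: "real \<Rightarrow> real" where
  "decay t = (1 - sin t) / (1 + sin t)"

lemma norm_decay:
  assumes "\<And>n. num t * g n = den t * g (Suc n)" and "1 + sin t \<noteq> 0"
  shows "(cmod (g n))\<^sup>2 = (cmod (g 0))\<^sup>2 * decay t ^ n"
proof (induction n)
  case (Suc n)
  have "(cmod (num t))\<^sup>2 * (cmod (g n))\<^sup>2 = (cmod (den t))\<^sup>2 * (cmod (g (Suc n)))\<^sup>2"
    using arg_cong[OF assms(1)[of n], of cmod] by (simp add: norm_mult flip: power_mult_distrib)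
  then have "(cmod (g (Suc n)))\<^sup>2 = decay t * (cmod (g n))\<^sup>2"
    using assms(2) by (simp add: cmod_num_sq cmod_den_sq decay_def field_simps)
  then show ?case using Suc by simp
qed simp

lemma decay_sums:
  assumes "0 < t" "t < pi"
  shows "(\<lambda>n. decay t ^ n) sums ((1 + sin t) / (2 * sin t))"
proof -
  have s: "0 < sin t" "sin t \<le> 1" using assms sin_gt_zero by auto
  then have "\<bar>decay t\<bar> < 1" by (simp add: decay_def field_simps)
  then have "(\<lambda>n. decay t ^ n) sums (1 / (1 - decay t))"
    by (intro geometric_sums) simp
  moreover have "1 / (1 - decay t) = (1 + sin t) / (2 * sin t)"
    using s by (simp add: decay_def field_simps)
  ultimately show ?thesis by simp
qed

lemma decay_suminf:
  assumes "0 < t" "t < pi"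
  shows "(\<Sum>n. ennreal (c\<^sup>2 * decay t ^ n)) = ennreal (c\<^sup>2 * ((1 + sin t) / (2 * sin t)))"
proof (rule suminf_ennreal_eq)
  show "0 \<le> c\<^sup>2 * decay t ^ n" for n
    using sin_le_one[of t] sin_gt_zero[OF assms] by (simp add: decay_def)
  show "(\<lambda>n. c\<^sup>2 * decay t ^ n) sums (c\<^sup>2 * ((1 + sin t) / (2 * sin t)))"
    by (intro sums_mult decay_sums assms)
qed

text \<open>The ratio is at least 1 on this half, so the terms do not tend to zero. At
  \<open>1 + sin t = 0\<close> division by zero would make \<open>decay t\<close> equal to 0, hence
  the exclusion of that point.\<close>

lemma decay_suminf_top:
  assumes "- pi < t" "t < 0" "1 + sin t \<noteq> 0" "c \<noteq> 0"
  shows "(\<Sum>n. ennreal (c\<^sup>2 * decay t ^ n)) = \<infinity>"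
proof (rule ccontr)
  assume fin: "(\<Sum>n. ennreal (c\<^sup>2 * decay t ^ n)) \<noteq> \<infinity>"
  have s: "sin t < 0" "0 < 1 + sin t"
    using sin_gt_zero[of "- t"] sin_ge_minus_one[of t] assms by (simp, linarith)
  then have d: "1 \<le> decay t"
    by (simp add: decay_def field_simps)
  have "summable (\<lambda>n. c\<^sup>2 * decay t ^ n)"
    using fin d by (intro summable_suminf_not_top) auto
  then have "(\<lambda>n. c\<^sup>2 * decay t ^ n) \<longlonglongrightarrow> 0"
    by (rule summable_LIMSEQ_zero)
  moreover have "c\<^sup>2 \<le> c\<^sup>2 * decay t ^ n" for n
    using mult_left_mono[OF one_le_power[OF d, of n], of "c\<^sup>2"] by simp
  ultimately have "c\<^sup>2 \<le> 0"
    by (intro LIMSEQ_le_const) auto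
  then show False
    using assms by simp
qed

text \<open>The discarded points are the zeros of the sine, where the ratio is 1, and -pi/2, where
  \<open>den\<close> vanishes.\<close>

lemma AE_circle_generic: "AE t in circle. - pi < t \<and> t < pi \<and> t \<noteq> 0 \<and> 1 + sin t \<noteq> 0"
proof -
  have "AE t in circle. t \<notin> {- pi, - pi / 2, 0, pi}"
    by (rule AE_circle_not_in) simp
  moreover have "AE t in circle. t \<in> {-pi..pi}"
    by (rule AE_I2) simp
  ultimately show ?thesis
  proof eventually_elim
    case (elim t)
    have "sin t \<noteq> - 1"
    proof
      assume "sin t = - 1"
      then have c: "cos t = 0"
        using sin_cos_squared_add[of t] by simp
      show False
      proof (cases "t > 0")
        case True
        then show False using sin_gt_zero[of t] elim \<open>sin t = - 1\<close> by auto
      next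
        case False
        then have "cos (- t) = cos (pi / 2)" using c by simp
        then have "- t = pi / 2"
          by (rule cos_inj_pi[rotated 4]) (use elim False pi_ge_zero in \<open>simp_all only: atLeastAtMost_iff, linarith+\<close>)
        then show False using elim by auto
      qed
    qed
    then show ?case using elim by auto
  qed
qed

text \<open>Monotone convergence moves the row sum inside the integral. For negative
  \<open>t\<close> both integrands vanish, the left one by the support condition and the right one
  by the indicator of \<open>{0..pi}\<close>.\<close>

lemma suminf_norm_sq:
  assumes [measurable]: "\<And>n. g n \<in> borel_measurable circle"
    and decay: "AE t in circle. \<forall>n. (cmod (g n t))\<^sup>2 = (cmod (g 0 t))\<^sup>2 * decay t ^ n"
    and supp: "AE t in circle. t < 0 \<longrightarrow> g 0 t = 0"
  shows "(\<Sum>n. norm_sq (g n)) = weighted_norm_sq (g 0)"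
proof -
  have "(\<Sum>n. norm_sq (g n)) = (\<integral>\<^sup>+t. (\<Sum>n. ennreal ((cmod (g n t))\<^sup>2)) \<partial>circle)"
    unfolding norm_sq_def by (rule nn_integral_suminf [symmetric]) measurable
  also have "\<dots> = weighted_norm_sq (g 0)"
    unfolding weighted_norm_sq_def
  proof (rule nn_integral_cong_AE, use decay supp AE_circle_generic in eventually_elim)
    case (elim t)
    have eq: "(\<lambda>n. ennreal ((cmod (g n t))\<^sup>2)) = (\<lambda>n. ennreal ((cmod (g 0 t))\<^sup>2 * decay t ^ n))"
      using elim(1) by (intro ext arg_cong[of _ _ ennreal]) blast
    show ?case
      unfolding eq using elim(2,3) by (cases "t < 0") (simp_all add: decay_suminf)
  qed
  finally show ?thesis .
qed

text \<open>A finite total makes the pointwise row sum finite almost everywhere, which a nonzero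
  value at a negative \<open>t\<close> would contradict by \<open>decay_suminf_top\<close>.\<close>

lemma decay_support:
  assumes [measurable]: "\<And>n. g n \<in> borel_measurable circle"
    and decay: "AE t in circle. \<forall>n. (cmod (g n t))\<^sup>2 = (cmod (g 0 t))\<^sup>2 * decay t ^ n"
    and fin: "(\<Sum>n. norm_sq (g n)) < \<infinity>"
  shows "AE t in circle. t < 0 \<longrightarrow> g 0 t = 0"
proof -
  have "(\<Sum>n. norm_sq (g n)) = (\<integral>\<^sup>+t. (\<Sum>n. ennreal ((cmod (g n t))\<^sup>2)) \<partial>circle)"
    unfolding norm_sq_def by (rule nn_integral_suminf [symmetric]) measurable
  then have "AE t in circle. (\<Sum>n. ennreal ((cmod (g n t))\<^sup>2)) \<noteq> \<infinity>"
    using fin by (intro nn_integral_noteq_infinite) auto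
  then show ?thesis
    using decay AE_circle_generic
  proof eventually_elim
    case (elim t)
    have eq: "(\<lambda>n. ennreal ((cmod (g n t))\<^sup>2)) = (\<lambda>n. ennreal ((cmod (g 0 t))\<^sup>2 * decay t ^ n))"
      using elim(2) by (intro ext arg_cong[of _ _ ennreal]) blast
    show ?case
      using elim(1,3) decay_suminf_top[of t "cmod (g 0 t)"] unfolding eq by auto
  qed
qed

lemma sum_le_infsum_ennreal:
  fixes f :: "'a \<Rightarrow> ennreal"
  assumes "finite F"
  shows "sum f F \<le> infsum f UNIV"
proof -
  have "infsum f F \<le> infsum f UNIV"
    by (rule infsum_mono_neutral) (auto intro: nonneg_summable_on_complete)
  then show ?thesis
    using assms by simp
qed

section \<open>The two inclusions and the norm identity\<close>

lemma bergman_norm_sq_fourier: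
  assumes "\<And>n. g n \<in> fourier (\<lambda>m. f m n)"
  shows "bergman_norm_sq f = (\<Sum>n. norm_sq (g n))"
  using parseval[OF assms] by (simp add: bergman_norm_sq_def)

lemma bergman_fourier_boundary:
  assumes f: "f \<in> bergman_space"
  shows "fourier (boundary f) \<noteq> {}"
    and "\<And>g. g \<in> fourier (boundary f) \<Longrightarrow> (AE t in circle. t < 0 \<longrightarrow> g t = 0) \<and> bergman_norm_sq f = weighted_norm_sq g"
proof -
  have hol: "discrete_holomorphic f" and fin: "bergman_norm_sq f < \<infinity>"
    using f by (auto simp: bergman_space_def)
  have "fourier (\<lambda>m. f m n) \<noteq> {}" for n
  proof -
    let ?s = "\<Sum>\<^sub>\<infinity>m. ennreal ((cmod (f m n))\<^sup>2)"
    have "?s < \<infinity>"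
      using fin ennreal_suminf_lessD unfolding bergman_norm_sq_def by blast
    then obtain C where C: "?s = ennreal C" "0 \<le> C"
      by (auto simp: less_top_ennreal)
    have "(\<Sum>m\<in>F. (cmod (f m n))\<^sup>2) \<le> C" if "finite F" for F
    proof -
      have "(\<Sum>m\<in>F. ennreal ((cmod (f m n))\<^sup>2)) \<le> ?s"
        by (rule sum_le_infsum_ennreal[OF that])
      then show ?thesis
        using C by (simp add: sum_ennreal)
    qed
    then have "(\<lambda>m. (cmod (f m n))\<^sup>2) summable_on UNIV"
      by (intro nonneg_bdd_above_summable_on) (auto intro!: bdd_aboveI2[of _ _ C])
    then show ?thesis
      by (rule riesz_fischer) blast
  qed
  then have "\<exists>G. \<forall>n. G n \<in> fourier (\<lambda>m. f m n)"
    by (intro choice) blast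
  then obtain G where G: "\<And>n. G n \<in> fourier (\<lambda>m. f m n)"
    by blast
  then show "fourier (boundary f) \<noteq> {}"
    unfolding boundary_def by blast
  fix g assume g: "g \<in> fourier (boundary f)"
  \<comment> \<open>Row 0 gets the given representative in place of the chosen one, so the
    conclusion holds for every element of \<open>fourier (boundary f)\<close>.\<close>
  define H where "H = G(0 := g)"
  have H: "H n \<in> fourier (\<lambda>m. f m n)" for n
    using G g by (simp add: H_def boundary_def)
  then have si: "H n \<in> square_integrable" for n
    by (simp add: fourier_iff)
  then have meas: "H n \<in> borel_measurable circle" for n
    by (rule square_integrable_measurable)
  have f_coef: "f m n = coef (H n) m" for m n
    using coef_fourier[OF H] by simp
  have "AE t in circle. \<forall>n. num t * H n t = den t * H (Suc n) t"
    using hol discrete_holomorphic_iff_AE[of H f, OF si f_coef] by simp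
  then have decay: "AE t in circle. \<forall>n. (cmod (H n t))\<^sup>2 = (cmod (H 0 t))\<^sup>2 * decay t ^ n"
    using AE_circle_generic by eventually_elim (auto intro: norm_decay)
  have sum: "bergman_norm_sq f = (\<Sum>n. norm_sq (H n))"
    by (rule bergman_norm_sq_fourier[OF H])
  have supp: "AE t in circle. t < 0 \<longrightarrow> H 0 t = 0"
    using fin sum by (intro decay_support meas decay) simp
  show "(AE t in circle. t < 0 \<longrightarrow> g t = 0) \<and> bergman_norm_sq f = weighted_norm_sq g"
    using supp suminf_norm_sq[OF meas decay supp] sum by (simp add: H_def)
qed

lemma weighted_norm_sq_cong_AE:
  assumes "AE t in circle. g t = h t"
  shows "weighted_norm_sq g = weighted_norm_sq h"
  unfolding weighted_norm_sq_def using assms by (intro nn_integral_cong_AE) auto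

lemma weighted_in_image:
  assumes g: "g \<in> square_integrable" and supp: "AE t in circle. - pi < t \<and> t < 0 \<longrightarrow> g t = 0"
    and fin: "weighted_norm_sq g < \<infinity>"
  obtains f where "f \<in> bergman_space" "g \<in> fourier (boundary f)"
proof -
  \<comment> \<open>The rows solve the multiplier equation recursively. The cut to the open interval
    makes the recursion hold at every \<open>t\<close>, as \<open>den\<close> has no zero there, and
    alters row 0 only on a null set.\<close>
  define G where "G n t = (if 0 < t \<and> t < pi then (num t / den t) ^ n * g t else 0)" for n t
  have [measurable]: "g \<in> borel_measurable circle"
    by (rule square_integrable_measurable[OF g])
  have meas: "G n \<in> borel_measurable circle" for n
  proof -
    have [measurable]: "(\<lambda>t. t) \<in> borel_measurable circle"
      by (intro continuous_imp_measurable_circle continuous_intros)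
    show ?thesis
      unfolding G_def by measurable
  qed
  have rec: "num t * G n t = den t * G (Suc n) t" for n t
  proof (cases "0 < t \<and> t < pi")
    case True
    then have "(cmod (den t))\<^sup>2 > 0"
      using sin_gt_zero[of t] by (simp add: cmod_den_sq)
    then have "den t \<noteq> 0" by auto
    then show ?thesis by (simp add: G_def)
  qed (auto simp: G_def)
  have decay: "AE t in circle. \<forall>n. (cmod (G n t))\<^sup>2 = (cmod (G 0 t))\<^sup>2 * decay t ^ n"
    using AE_circle_generic by eventually_elim (auto intro!: norm_decay rec)
  have G0: "AE t in circle. g t = G 0 t"
    using supp AE_circle_generic by eventually_elim (auto simp: G_def)
  have si: "G n \<in> square_integrable" for n
  proof (rule square_integrable_mono[OF g meas, of _ 1], intro always_eventually allI)
    fix t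
    show "cmod (G n t) \<le> 1 * cmod (g t)"
    proof (cases "0 < t \<and> t < pi")
      case True
      then have "(cmod (num t))\<^sup>2 \<le> (cmod (den t))\<^sup>2"
        using sin_gt_zero[of t] by (simp add: cmod_num_sq cmod_den_sq)
      then have "cmod (num t / den t) \<le> 1"
        by (auto simp: norm_divide divide_le_eq_1)
      then have "cmod ((num t / den t) ^ n) \<le> 1"
        unfolding norm_power by (intro power_le_one) auto
      then show ?thesis
        using True by (simp add: G_def norm_mult mult_left_le_one_le)
    qed (auto simp: G_def)
  qed
  define f where "f m n = coef (G n) m" for m n
  have "f \<in> bergman_space"
  proof -
    have "discrete_holomorphic f"
      using discrete_holomorphic_iff_AE[OF si f_def] rec by simp
    moreover have "bergman_norm_sq f = weighted_norm_sq (G 0)"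
    proof -
      have "G n \<in> fourier (\<lambda>m. f m n)" for n
        using fourier_coef[OF si] by (simp add: f_def)
      then have "bergman_norm_sq f = (\<Sum>n. norm_sq (G n))"
        by (rule bergman_norm_sq_fourier)
      also have "\<dots> = weighted_norm_sq (G 0)"
        by (rule suminf_norm_sq[OF meas decay]) (simp add: G_def)
      finally show ?thesis .
    qed
    ultimately show ?thesis
      using fin weighted_norm_sq_cong_AE[OF G0] by (simp add: bergman_space_def)
  qed
  \<comment> \<open>The boundary of \<open>f\<close> consists of the coefficients of
    \<open>G 0\<close>, which are those of \<open>g\<close>.\<close>
  moreover have "g \<in> fourier (boundary f)"
    using fourier_coef[OF g] coef_cong_AE[OF _ meas[of 0]] G0 by (simp add: boundary_def f_def)
  ultimately show thesis
    by (rule that)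
qed

theorem theorem8p1:
  "fourier ` boundary ` bergman_space = weighted_space \<and>
   (\<forall>f\<in>bergman_space. \<forall>g\<in>fourier (boundary f). bergman_norm_sq f = weighted_norm_sq g)"
proof (intro conjI ballI equalityI subsetI)
  fix K assume "K \<in> fourier ` boundary ` bergman_space"
  then obtain f where f: "f \<in> bergman_space" and K: "K = fourier (boundary f)"
    by blast
  obtain g where g: "g \<in> fourier (boundary f)"
    using bergman_fourier_boundary(1)[OF f] by blast
  have "(AE t in circle. t < 0 \<longrightarrow> g t = 0) \<and> bergman_norm_sq f = weighted_norm_sq g"
    by (rule bergman_fourier_boundary(2)[OF f g])
  then have "(AE t in circle. - pi < t \<and> t < 0 \<longrightarrow> g t = 0)" "weighted_norm_sq g < \<infinity>"
    using f by (auto simp: bergman_space_def elim: eventually_mono)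
  moreover have "g \<in> square_integrable"
    using g by (simp add: fourier_iff)
  ultimately show "K \<in> weighted_space"
    \<comment> \<open>The whole set \<open>fourier (boundary f)\<close> is the class of
      \<open>g\<close>, so one representative decides membership.\<close>
    unfolding K fourier_eq_L2_class[OF g] weighted_space_def by blast
next
  fix K assume "K \<in> weighted_space"
  then obtain g where g: "g \<in> square_integrable" "AE t in circle. - pi < t \<and> t < 0 \<longrightarrow> g t = 0"
      "weighted_norm_sq g < \<infinity>" and K: "K = L2_class g"
    unfolding weighted_space_def by blast
  obtain f where "f \<in> bergman_space" "g \<in> fourier (boundary f)"
    by (rule weighted_in_image[OF g])
  then show "K \<in> fourier ` boundary ` bergman_space"
    unfolding K fourier_eq_L2_class[OF \<open>g \<in> fourier (boundary f)\<close>, symmetric] by blast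
next
  fix f g assume "f \<in> bergman_space" "g \<in> fourier (boundary f)"
  then show "bergman_norm_sq f = weighted_norm_sq g"
    using bergman_fourier_boundary(2) by blast
qed

end
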